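(* Let $(\mathbb{X}(H))_{H\ge1}$ be finite nonempty subsets of $\mathbb{R}$ and $\mu_H=\frac{1}{\#\mathbb{X}(H)}\sum_{\alpha\in\mathbb{X}(H)}\delta_{\alpha-\lfloor\alpha\rfloor}$. Assume $(\mu_H)$ converges weakly to a probability measure on $[0,1]$ with continuous, strictly positive density $\rho:[0,1]\to\mathbb{R}_{>0}$, and that $E:\mathbb{N}\to\mathbb{R}_{\ge0}$ satisfies $\sup_I|\mu_H(I)-\int_I\rho|\le E(H)$ for all $H\ge1$, the supremum over all subintervals $I\subset[0,1]$. Let $\Psi:\mathbb{R}_{>0}\to\mathbb{R}_{>0}$ be an approximation function, $Q_2>Q_1\ge1$ integers, $H\ge1$ an integer, and write $J=J_\Psi(Q_1,Q_2)$, $\widetilde J$ the closure of $[0,1]\setminus J$, and $P=\#\{\alpha\in\mathbb{X}(H):\alpha-\lfloor\alpha\rfloor\in J\}/\#\mathbb{X}(H)$. \begin{itemize} \item (Upper bound.) Let $\delta\in(0,1)$ and assume $\Theta:=\min_{Q_1\le q<Q_2}2\Psi(q)/q<\nu_\rho(\delta)$. Then $$P\le 4\int_J\rho+\left(\frac{8\delta}{1-\delta}+\frac{E(H)}{\Theta\cdot\min\rho}\right)\left(|J|\,\eta_\rho(\Theta)+\int_J\rho\right)+4|J|\,\eta_\rho(\Theta).$$ \item (Lower bound.) Let $\delta\in(0,1)$ be such that $0<\ell:=len^*(\widetilde J)<\nu_\rho(\delta)$. Then $$1-P\le 4\int_{\widetilde J}\rho+\left(\frac{8\delta}{1-\delta}+\frac{E(H)}{\ell\cdot\min\rho}\right)\left(|\widetilde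 J|\,\eta_\rho(\ell)+\int_{\widetilde J}\rho\right)+4|\widetilde J_{\Psi/2}(Q_1,Q_2)|\,\eta_\rho(\ell),$$ where $\widetilde J_{\Psi/2}(Q_1,Q_2)$ is the closure of $[0,1]\setminus J_{\Psi/2}(Q_1,Q_2)$. \item Furthermore, if $len^*(\widetilde J)=0$, then $J=[0,1]$. \end{itemize}
   Context: An approximation function is a nonincreasing function tending to $0$ at infinity. $B^*(x,r)=[x-r,x+r]\cap[0,1]$ and $J_\Psi(Q_1,Q_2)=\bigcup_{Q_1\le q<Q_2}\bigcup_{0\le p\le q}B^*(p/q,\Psi(q)/q)$ (and $J_{\Psi/2}$ is the same with $\Psi$ replaced by $\Psi/2$). $|\cdot|$ is Lebesgue measure and $\min\rho=\min_{[0,1]}\rho$. For a finite union of closed intervals $\Omega\subset[0,1]$, $len^*(\Omega)$ is the minimal length of its connected components (taken to be $0$ if $\Omega=\emptyset$). For $\varepsilon>0$, $\eta_\rho(\varepsilon)$ is the infimum of all $\eta>0$ such that $|\rho(x)-\rho(y)|\le\eta$ whenever $x,y\in[0,1]$, $|x-y|\le\varepsilon$; for $\delta>0$, $\nu_\rho(\delta)=\sup\{\varepsilon>0:\eta_\rho(\varepsilon)\in[0,\delta\min\rho]\}$. *)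

theory Defs
  imports "HOL-Probability.Probability"
begin

text \<open>Maps from the positive reals to the positive reals are total functions on \<open>real\<close>
  whose values at nonpositive arguments are unconstrained; likewise densities
  \<open>\<rho>\<close> on the unit interval are functions on \<open>real\<close> of which only the values
  on \<open>{0..1}\<close> matter.\<close>

definition approximation_function :: "(real \<Rightarrow> real) \<Rightarrow> bool" where
  "approximation_function \<Psi> \<longleftrightarrow>
     (\<forall>x>0. \<Psi> x > 0) \<and> antimono_on {0<..} \<Psi> \<and> (\<Psi> \<longlongrightarrow> 0) at_top"

definition Bstar :: "real \<Rightarrow> real \<Rightarrow> real set" where
  "Bstar x r = {x - r..x + r} \<inter> {0..1}"

definition Jset :: "(real \<Rightarrow> real) \<Rightarrow> nat \<Rightarrow> nat \<Rightarrow> real set" where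
  "Jset \<Psi> Q1 Q2 = (\<Union>q\<in>{Q1..<Q2}. \<Union>p\<in>{0..q}. Bstar (real p / real q) (\<Psi> (real q) / real q))"

definition Jtilde :: "(real \<Rightarrow> real) \<Rightarrow> nat \<Rightarrow> nat \<Rightarrow> real set" where
  "Jtilde \<Psi> Q1 Q2 = closure ({0..1} - Jset \<Psi> Q1 Q2)"

text \<open>Only meaningful for finite unions of closed intervals, which have finitely many
  components.\<close>

definition len_star :: "real set \<Rightarrow> real" where
  "len_star \<Omega> = (if \<Omega> = {} then 0 else Min (measure lborel ` components \<Omega>))"

definition min_density :: "(real \<Rightarrow> real) \<Rightarrow> real" where
  "min_density \<rho> = (INF x\<in>{0..1}. \<rho> x)"

definition eta :: "(real \<Rightarrow> real) \<Rightarrow> real \<Rightarrow> real" where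
  "eta \<rho> \<epsilon> = Inf {\<eta>. \<eta> > 0 \<and>
     (\<forall>x\<in>{0..1}. \<forall>y\<in>{0..1}. \<bar>x - y\<bar> \<le> \<epsilon> \<longrightarrow> \<bar>\<rho> x - \<rho> y\<bar> \<le> \<eta>)}"

text \<open>The supremum is taken in the extended reals: it is infinite as soon as the oscillation of
  \<open>\<rho>\<close> on the whole unit interval is at most \<open>\<delta>\<close> times its minimum
  (for instance for constant \<open>\<rho>\<close>).\<close>

definition nu :: "(real \<Rightarrow> real) \<Rightarrow> real \<Rightarrow> ereal" where
  "nu \<rho> \<delta> = (SUP \<epsilon>\<in>{\<epsilon>. \<epsilon> > 0 \<and> eta \<rho> \<epsilon> \<in> {0..\<delta> * min_density \<rho>}}. ereal \<epsilon>)"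

text \<open>The normalised sum of Dirac masses at the fractional parts of the elements of a finite
  nonempty set, counted with multiplicity, is the image under \<^const>\<open>frac\<close> of the uniform
  distribution on that set.\<close>

definition frac_measure :: "real set \<Rightarrow> real measure" where
  "frac_measure X = distr (uniform_count_measure X) borel frac"

lemma measure_frac_measure:
  assumes "finite X" and "X \<noteq> {}" and "B \<in> sets borel"
  shows "measure (frac_measure X) B =
    (1 / real (card X)) * (\<Sum>\<alpha>\<in>X. measure (return borel (frac \<alpha>)) B)"
proof -
  have "measure (frac_measure X) B = measure (uniform_count_measure X) (frac -` B \<inter> X)"
    using assms unfolding frac_measure_def
    by (subst measure_distr) (auto simp: measurable_def space_uniform_count_measure
        sets_uniform_count_measure)
  also have "\<dots> = real (card (frac -` B \<inter> X)) / real (card X)"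
    using assms by (subst measure_uniform_count_measure) auto
  also have "real (card (frac -` B \<inter> X)) = (\<Sum>\<alpha>\<in>X. indicator B (frac \<alpha>))"
    using assms(1) by (simp add: indicator_def Int_def vimage_def conj_commute
        flip: sum.inter_filter)
  also have "\<dots> = (\<Sum>\<alpha>\<in>X. measure (return borel (frac \<alpha>)) B)"
    using assms(3) by (simp add: measure_return)
  finally show ?thesis by simp
qed

definition density_measure :: "(real \<Rightarrow> real) \<Rightarrow> real measure" where
  "density_measure \<rho> = density lborel (\<lambda>x. ennreal (\<rho> x * indicator {0..1} x))"

end

theory Submission imports Defs begin

text \<open>
  Let \<open>U = [0,1] - J\<close>. Each component of \<open>U\<close> is an interval, so the empirical
  measure of \<open>U\<close> differs from \<open>\<integral>\<^sub>U \<rho>\<close> by at most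
  \<open>n E(H)\<close>, where \<open>n\<close> is the number of these components; passing to complements gives
  \<open>P \<le> \<integral>\<^sub>J \<rho> + n E(H)\<close>. Working with the gaps rather than with the components
  of \<open>J\<close> glues the two half-intervals at \<open>0\<close> and \<open>1\<close> together, which is what makes
  \<open>n \<Theta> \<le> |J|\<close> true without a factor \<open>2\<close>. For the lower bound, the components of
  the closure of \<open>U\<close> number at most \<open>|closure U| / l\<close>, by definition of \<open>l\<close>.
  In both cases \<open>min \<rho> |A| \<le> \<integral>\<^sub>A \<rho>\<close> turns the error into the second term of
  the bound; the terms with \<open>\<delta>\<close> and \<open>\<eta>\<close> only add nonnegative amounts.
\<close>

section \<open>Connected components of finite unions of connected sets, and cutting
  intervals\<close>

text \<open>By maximality a component contains every member of \<open>F\<close> that it meets.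
  Choosing a nonempty such member for each component is injective, because distinct components are
  disjoint.\<close>

lemma finite_components_Union:
  assumes "finite F" and conn: "\<And>I. I \<in> F \<Longrightarrow> connected I"
  shows "finite (components (\<Union>F))"
proof -
  have "\<exists>I\<in>F. I \<noteq> {} \<and> I \<subseteq> C" if C: "C \<in> components (\<Union>F)" for C
  proof -
    obtain x where x: "x \<in> C" using in_components_nonempty[OF C] by blast
    moreover have "C \<subseteq> \<Union>F" using C by (rule in_components_subset)
    ultimately obtain I where I: "I \<in> F" "x \<in> I" by blast
    have "I \<subseteq> C"
      using I x by (intro components_maximal[OF C conn]) auto
    then show ?thesis using I by blast
  qed
  then obtain f where f: "\<And>C. C \<in> components (\<Union>F) \<Longrightarrow> f C \<in> F \<and> f C \<noteq> {} \<and> f C \<subseteq> C"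
    by metis
  have "inj_on f (components (\<Union>F))"
  proof (rule inj_onI)
    fix C D assume C: "C \<in> components (\<Union>F)" and D: "D \<in> components (\<Union>F)" and "f C = f D"
    then have "C \<inter> D \<noteq> {}" using f[OF C] f[OF D] by auto
    then show "C = D" using components_nonoverlap[OF C D] by simp
  qed
  moreover have "f ` components (\<Union>F) \<subseteq> F" using f by auto
  ultimately show ?thesis using \<open>finite F\<close> by (rule inj_on_finite)
qed

lemma disjoint_components: "disjoint (components S)"
  using pairwise_disjoint_components[of S] by (simp add: pairwise_def disjnt_def)

text \<open>Induction on the removed intervals: each removal cuts every piece into its part left of
  \<open>l i\<close> and its part right of \<open>u i\<close>, which are again open intervals. The
  pieces may be empty.\<close>

lemma Diff_closed_intervals_decompose:
  fixes l u :: "'i \<Rightarrow> real"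
  assumes "finite S"
  shows "\<exists>F. finite F \<and> (\<forall>I\<in>F. open I \<and> is_interval I) \<and> \<Union>F = {a<..<b} - (\<Union>i\<in>S. {l i..u i})"
  using assms
proof (induction S)
  case empty
  show ?case by (intro exI[of _ "{{a<..<b}}"]) (auto simp: is_interval_oo)
next
  case (insert i S)
  then obtain F where F: "finite F" "\<And>I. I \<in> F \<Longrightarrow> open I \<and> is_interval I"
    "\<Union>F = {a<..<b} - (\<Union>i\<in>S. {l i..u i})" by auto
  show ?case
  proof (cases "l i \<le> u i")
    case True
    let ?G = "(\<lambda>I. I \<inter> {..<l i}) ` F \<union> (\<lambda>I. I \<inter> {u i<..}) ` F"
    have "\<Union>?G = \<Union>F - {l i..u i}" using True by auto
    also have "\<dots> = {a<..<b} - (\<Union>i\<in>insert i S. {l i..u i})" using F(3) by auto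
    finally have "\<Union>?G = {a<..<b} - (\<Union>i\<in>insert i S. {l i..u i})" .
    moreover have "\<forall>I\<in>?G. open I \<and> is_interval I"
      using F(2) by (auto intro!: is_interval_Int open_Int)
    ultimately show ?thesis using F(1) by (intro exI[of _ ?G]) simp
  next
    case False
    then show ?thesis using F by (intro exI[of _ F]) auto
  qed
qed

section \<open>The set \<open>J\<close> and its complement in the unit interval\<close>

text \<open>Brings \<open>J\<close> into the form of a single finite union of closed intervals, as
  in \<open>Diff_closed_intervals_decompose\<close>. In an index pair, \<open>fst i\<close> is the
  denominator and \<open>snd i\<close> the numerator.\<close>

lemma Jset_eq:
  "Jset \<Psi> Q1 Q2 = {0..1} \<inter> (\<Union>i\<in>Sigma {Q1..<Q2} (\<lambda>q. {0..q}).
     {real (snd i) / real (fst i) - \<Psi> (real (fst i)) / real (fst i)..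
      real (snd i) / real (fst i) + \<Psi> (real (fst i)) / real (fst i)})"
proof -
  have "(\<Union>q\<in>A. \<Union>p\<in>B q. C q p \<inter> K) = K \<inter> (\<Union>i\<in>Sigma A B. C (fst i) (snd i))"
    for A :: "nat set" and B :: "nat \<Rightarrow> nat set" and C :: "nat \<Rightarrow> nat \<Rightarrow> real set" and K
    by force
  then show ?thesis unfolding Jset_def Bstar_def .
qed

lemma Jset_subset: "Jset \<Psi> Q1 Q2 \<subseteq> {0..1}"
  unfolding Jset_eq by blast

lemma closed_Jset: "closed (Jset \<Psi> Q1 Q2)"
  unfolding Jset_eq by (intro closed_Int closed_UN) auto

lemma Jset_ballI:
  assumes "q \<in> {Q1..<Q2}" "p \<le> q" "x \<in> {0..1}"
    and "real p / real q - \<Psi> (real q) / real q \<le> x" "x \<le> real p / real q + \<Psi> (real q) / real q"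
  shows "x \<in> Jset \<Psi> Q1 Q2"
proof -
  have "x \<in> Bstar (real p / real q) (\<Psi> (real q) / real q)" "p \<in> {0..q}"
    using assms by (simp_all add: Bstar_def)
  then show ?thesis unfolding Jset_def using assms(1) by blast
qed

lemma Jset_left_endI:
  assumes "q \<in> {Q1..<Q2}" "x \<in> {0..1}" "x \<le> \<Psi> (real q) / real q"
  shows "x \<in> Jset \<Psi> Q1 Q2"
  using assms by (intro Jset_ballI[of q Q1 Q2 0]) auto

lemma Jset_right_endI:
  assumes "1 \<le> q" "q \<in> {Q1..<Q2}" "x \<in> {0..1}" "1 - \<Psi> (real q) / real q \<le> x"
  shows "x \<in> Jset \<Psi> Q1 Q2"
  using assms by (intro Jset_ballI[of q Q1 Q2 q]) auto

text \<open>The balls around 0 and 1 = \<open>Q1\<close>/\<open>Q1\<close> have positive radius, so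
  both endpoints lie in \<open>J\<close>. Hence the complement can be taken in the open unit
  interval, which is why the pieces come out open.\<close>

lemma Compl_Jset_decompose:
  assumes \<Psi>: "\<And>x. x > 0 \<Longrightarrow> \<Psi> x > 0" and Q: "1 \<le> Q1" "Q1 < Q2"
  shows "\<exists>F. finite F \<and> (\<forall>I\<in>F. open I \<and> is_interval I) \<and> \<Union>F = {0..1} - Jset \<Psi> Q1 Q2"
proof -
  have "\<Psi> (real Q1) / real Q1 > 0" using \<Psi> Q by simp
  then have "0 \<in> Jset \<Psi> Q1 Q2" "1 \<in> Jset \<Psi> Q1 Q2"
    using Q by (simp_all add: Jset_left_endI[of Q1] Jset_right_endI[of Q1])
  moreover have "{0..1} - K = {0<..<1} - K" if "0 \<in> K" "1 \<in> K" for K :: "real set"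
    using that by (auto simp: order_less_le)
  ultimately have "{0..1} - Jset \<Psi> Q1 Q2 = {0<..<1} - Jset \<Psi> Q1 Q2" by blast
  moreover have "{0<..<1} - {0..1} \<inter> K = {0<..<1} - K" for K :: "real set"
    by auto
  ultimately have eq: "{0..1} - Jset \<Psi> Q1 Q2 = {0<..<1} - (\<Union>i\<in>Sigma {Q1..<Q2} (\<lambda>q. {0..q}).
     {real (snd i) / real (fst i) - \<Psi> (real (fst i)) / real (fst i)..
      real (snd i) / real (fst i) + \<Psi> (real (fst i)) / real (fst i)})"
    unfolding Jset_eq by simp
  have "finite (Sigma {Q1..<Q2} (\<lambda>q. {0..q}))" by simp
  then show ?thesis unfolding eq by (rule Diff_closed_intervals_decompose)
qed

section \<open>Lengths of components of the closure, and the number of gaps of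
  \<open>J\<close>\<close>

text \<open>Closure commutes with finite unions, so each component of the closure contains a
  nonempty open member of \<open>F\<close> and with it a ball. This is what later keeps
  \<open>len_star\<close> positive on nonempty sets.\<close>

lemma components_closure_Union:
  fixes F :: "'a::euclidean_space set set"
  assumes F: "finite F" "\<And>I. I \<in> F \<Longrightarrow> open I \<and> connected I" and bdd: "bounded (\<Union>F)"
  shows "finite (components (closure (\<Union>F)))"
    and "\<And>C. C \<in> components (closure (\<Union>F)) \<Longrightarrow> measure lborel C > 0"
proof -
  have eq: "closure (\<Union>F) = \<Union>(closure ` F)"
    using F(1) by (induction F rule: finite_induct) auto
  have "finite (components (\<Union>(closure ` F)))"
    using F by (intro finite_components_Union) (auto intro: connected_imp_connected_closure)
  then show "finite (components (closure (\<Union>F)))" by (simp add: eq)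
  fix C assume C: "C \<in> components (closure (\<Union>F))"
  obtain x where x: "x \<in> C" using in_components_nonempty[OF C] by blast
  then obtain I where I: "I \<in> F" "x \<in> closure I" using in_components_subset[OF C] eq by auto
  have "closure I \<subseteq> C"
    using I x F eq
    by (intro components_maximal[OF C]) (auto intro: connected_imp_connected_closure)
  then have "I \<subseteq> C" using closure_subset by blast
  moreover have "I \<noteq> {}" using I by auto
  ultimately obtain y where "y \<in> I" by blast
  then obtain e where e: "e > 0" "ball y e \<subseteq> I" using F(2)[OF I(1)] openE by metis
  \<comment> \<open>Compactness makes the measure of \<open>C\<close> finite; on sets of infinite
    measure \<open>measure\<close> returns 0 and would not be monotone.\<close>
  have Cc: "compact C"
    using closed_components[OF closed_closure C] bounded_subset[OF bounded_closure[OF bdd] in_components_subset[OF C]]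
    by (simp add: compact_eq_bounded_closed)
  have "0 < measure lborel (ball y e)"
    using content_ball_pos[OF e(1), of y] by simp
  also have "\<dots> \<le> measure lborel C"
    using e \<open>I \<subseteq> C\<close> Cc by (intro measure_mono_fmeasurable fmeasurable_compact) auto
  finally show "measure lborel C > 0" .
qed

text \<open>The half-open interval of length \<open>\<theta>\<close> following a gap of \<open>J\<close> lies
  in \<open>J\<close>, apart from a piece beyond \<open>1\<close> of length at most \<open>\<theta> / 2\<close>; that
  piece is made up for by the initial part of \<open>J\<close>, which precedes every gap.\<close>
lemma card_gaps_le:
  fixes \<theta> :: real
  assumes \<Psi>: "\<And>x. x > 0 \<Longrightarrow> \<Psi> x > 0" and Q: "1 \<le> Q1" "Q1 < Q2" and "\<theta> > 0"
    and \<theta>: "\<And>q. q \<in> {Q1..<Q2} \<Longrightarrow> \<theta> \<le> 2 * \<Psi> (real q) / real q"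
  shows "real (card (components ({0..1} - Jset \<Psi> Q1 Q2))) * \<theta> \<le> measure lborel (Jset \<Psi> Q1 Q2)"
proof (cases "{0..1} \<subseteq> Jset \<Psi> Q1 Q2")
  case True
  then have empty: "{0..1} - Jset \<Psi> Q1 Q2 = {}" by blast
  show ?thesis unfolding empty by simp
next
  case False
  define J where "J = Jset \<Psi> Q1 Q2"
  define U where "U = {0..1} - J"
  have "\<exists>F. finite F \<and> (\<forall>I\<in>F. open I \<and> is_interval I) \<and> \<Union>F = U"
    unfolding U_def J_def by (rule Compl_Jset_decompose[OF \<Psi> Q])
  then obtain F where "finite F \<and> (\<forall>I\<in>F. open I \<and> is_interval I) \<and> \<Union>F = U" ..
  then have F: "finite F" "\<And>I. I \<in> F \<Longrightarrow> open I \<and> is_interval I" "\<Union>F = U"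
    by simp_all
  have fin: "finite (components U)"
    unfolding F(3)[symmetric]
    using F(1,2) by (intro finite_components_Union) (auto simp: is_interval_connected)
  have "open U" using F(2,3) by blast
  define r where "r q = \<Psi> (real q) / real q" for q :: nat
  have half: "\<theta> / 2 \<le> r q" if "q \<in> {Q1..<Q2}" for q
    using \<theta>[OF that] by (simp add: r_def mult.commute)
  have ballI: "x \<in> J" if "q \<in> {Q1..<Q2}" "p \<le> q" "0 \<le> x" "x \<le> 1"
    "real p / real q - r q \<le> x" "x \<le> real p / real q + r q" for q p x
    unfolding J_def using that by (intro Jset_ballI[of q Q1 Q2 p]) (simp_all add: r_def)
  have Q1: "Q1 \<in> {Q1..<Q2}" using Q by simp
  have left: "x \<in> J" if "0 \<le> x" "x \<le> 1" "x \<le> \<theta> / 2" for x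
    using that half[OF Q1] \<open>\<theta> > 0\<close> by (intro ballI[of Q1 0]) (use Q1 in auto)
  have right: "x \<in> J" if "0 \<le> x" "x \<le> 1" "1 - \<theta> / 2 \<le> x" for x
    using that half[OF Q1] \<open>\<theta> > 0\<close> Q(1) by (intro ballI[of Q1 Q1]) (use Q1 in auto)
  have U: "\<theta> / 2 < x \<and> x < 1 - \<theta> / 2" if "x \<in> U" for x
    using that left[of x] right[of x] by (force simp: U_def)
  \<comment> \<open>A point of a gap lies strictly between \<theta>/2 and 1 - \<theta>/2. The
    resulting \<open>\<theta> / 2 < 1\<close> later places \<open>{0..<\<theta> / 2}\<close> inside
    the unit interval.\<close>
  obtain u where "u \<in> U" using False unfolding U_def J_def by blast
  then have "\<theta> / 2 < 1" using U[of u] \<open>\<theta> > 0\<close> by linarith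
  have C: "C \<noteq> {}" "C \<subseteq> U" "open C" "is_interval C" "bdd_above C" if "C \<in> components U" for C
  proof -
    show "C \<noteq> {}" "C \<subseteq> U" using in_components_nonempty[OF that] in_components_subset[OF that] by simp_all
    show "open C" using open_components[OF \<open>open U\<close> that] .
    show "is_interval C" unfolding is_interval_connected_1 by (rule in_components_connected[OF that])
    show "bdd_above C"
    proof (rule bdd_aboveI)
      fix x assume "x \<in> C"
      then have "x \<in> U" using \<open>C \<subseteq> U\<close> by blast
      then show "x \<le> 1 - \<theta> / 2" using U by (simp add: less_imp_le)
    qed
  qed
  \<comment> \<open>An open \<open>C\<close> does not attain its supremum: next to a point
    \<open>c\<close> of \<open>C\<close> there is a larger one, so \<open>c < Sup C\<close>.\<close>
  have near: "\<exists>c\<in>C. y < c \<and> c < Sup C" if CC: "C \<in> components U" and y: "y < Sup C" for C y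
  proof -
    obtain c where c: "c \<in> C" "y < c" using less_cSupD[OF C(1)[OF CC] y] by blast
    obtain e where "e > 0" "ball c e \<subseteq> C" using C(3)[OF CC] c(1) openE by metis
    then have "c + e / 2 \<in> C" by (auto simp: dist_real_def subset_iff)
    then have "c + e / 2 \<le> Sup C" using C(5)[OF CC] by (rule cSup_upper)
    then show ?thesis using c \<open>e > 0\<close> by (intro bexI[of _ c]) auto
  qed
  have Sup_bounds: "\<theta> / 2 < Sup C" "Sup C \<le> 1 - \<theta> / 2" if CC: "C \<in> components U" for C
  proof -
    obtain c where c: "c \<in> C" using C(1)[OF CC] by blast
    then show "\<theta> / 2 < Sup C"
      using cSup_upper[OF c C(5)[OF CC]] U[of c] C(2)[OF CC] by force
    show "Sup C \<le> 1 - \<theta> / 2" using C(1,2)[OF CC] U by (intro cSup_least) (auto intro: less_imp_le)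
  qed
  \<comment> \<open>Otherwise \<open>C\<close> with its supremum adjoined would be a connected
    subset of \<open>U\<close>, hence equal to \<open>C\<close> by maximality, and the open set
    \<open>C\<close> would attain its supremum.\<close>
  have Sup_J: "Sup C \<in> J" if CC: "C \<in> components U" for C
  proof (rule ccontr)
    assume "Sup C \<notin> J"
    then have "Sup C \<in> U" using Sup_bounds[OF CC] \<open>\<theta> > 0\<close> by (auto simp: U_def)
    moreover have "connected (insert (Sup C) C)"
      using closure_contains_Sup[OF C(1)[OF CC] C(5)[OF CC]] closure_subset[of C]
      by (intro connected_intermediate_closure[OF in_components_connected[OF CC]]) auto
    ultimately have "insert (Sup C) C \<subseteq> C"
      using C(1,2)[OF CC] by (intro components_maximal[OF CC]) auto
    then obtain e where "e > 0" "ball (Sup C) e \<subseteq> C" using C(3)[OF CC] openE by (metis insert_subset)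
    then have "Sup C + e / 2 \<in> C" by (auto simp: dist_real_def subset_iff)
    from cSup_upper[OF this C(5)[OF CC]] \<open>e > 0\<close> show False by simp
  qed
  \<comment> \<open>Take a ball containing \<open>Sup C\<close>. It cannot begin before
    \<open>Sup C\<close>, since it would then contain points of the gap \<open>C\<close>. So it
    begins exactly there and extends over a length of at least \<theta>, twice the lower bound
    \<theta>/2 for the radii.\<close>
  have after: "x \<in> J" if CC: "C \<in> components U" and x: "Sup C \<le> x" "x < Sup C + \<theta>" "x \<le> 1" for C x
  proof -
    obtain q p where qp: "q \<in> {Q1..<Q2}" "p \<le> q" and "Sup C \<in> Bstar (real p / real q) (r q)"
      using Sup_J[OF CC] unfolding J_def Jset_def r_def by auto
    then have S: "real p / real q - r q \<le> Sup C" "Sup C \<le> real p / real q + r q"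
      by (simp_all add: Bstar_def)
    have "Sup C \<le> real p / real q - r q"
    proof (rule ccontr)
      assume "\<not> ?thesis"
      then obtain c where c: "c \<in> C" "real p / real q - r q < c" "c < Sup C"
        using near[OF CC, of "real p / real q - r q"] by auto
      have "c \<in> U" using c C(2)[OF CC] by blast
      then have "0 \<le> c" "c \<le> 1" "c \<notin> J" by (auto simp: U_def)
      moreover have "c \<in> J"
        using c S \<open>0 \<le> c\<close> \<open>c \<le> 1\<close> by (intro ballI[OF qp]) linarith+
      ultimately show False by blast
    qed
    then show ?thesis
      using half[OF qp(1)] x Sup_bounds(1)[OF CC] S \<open>\<theta> > 0\<close>
      by (intro ballI[OF qp]) linarith+
  qed
  define D where "D C = {Sup C..<Sup C + \<theta>}" for C :: "real set"
  \<comment> \<open>An overlap would put points of the gap \<open>C'\<close> just below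
    \<open>Sup C'\<close> into the stretch of \<open>J\<close> that follows
    \<open>C\<close>.\<close>
  have disj_less: "D C \<inter> D C' = {}"
    if CC: "C \<in> components U" "C' \<in> components U" "Sup C < Sup C'" for C C'
  proof (rule ccontr)
    assume "\<not> ?thesis"
    then have "Sup C' < Sup C + \<theta>" by (auto simp: D_def)
    moreover obtain c where "c \<in> C'" "Sup C < c" "c < Sup C'" using near[OF CC(2,3)] by blast
    ultimately have "c \<in> J" using Sup_bounds(2)[OF CC(2)] \<open>\<theta> > 0\<close> by (intro after[OF CC(1)]) auto
    then show False using C(2)[OF CC(2)] \<open>c \<in> C'\<close> by (auto simp: U_def)
  qed
  \<comment> \<open>With equal suprema the points of both gaps interleave: some \<open>c'\<close> of
    \<open>C'\<close> lies between \<open>c\<close> and \<open>d\<close> of the interval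
    \<open>C\<close>, so the two components meet.\<close>
  have Sup_inj: "C = C'" if CC: "C \<in> components U" "C' \<in> components U" "Sup C = Sup C'" for C C'
  proof -
    obtain c where c: "c \<in> C" using C(1)[OF CC(1)] by blast
    then obtain e where "e > 0" "ball c e \<subseteq> C" using C(3)[OF CC(1)] openE by metis
    then have "c + e / 2 \<in> C" by (auto simp: dist_real_def subset_iff)
    from cSup_upper[OF this C(5)[OF CC(1)]] have "c < Sup C'" using \<open>e > 0\<close> CC(3) by simp
    then obtain c' where c': "c' \<in> C'" "c < c'" "c' < Sup C" using near[OF CC(2)] CC(3) by metis
    then obtain d where d: "d \<in> C" "c' < d" using near[OF CC(1)] by metis
    have "c' \<in> C"
      using C(4)[OF CC(1)] c d c' unfolding is_interval_1 by (meson less_imp_le)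
    then show ?thesis using c'(1) components_nonoverlap[OF CC(1,2)] by blast
  qed
  have "disjoint_family_on D (components U)"
    unfolding disjoint_family_on_def using disj_less Sup_inj
    by (metis Int_commute linorder_less_linear)
  moreover have D: "emeasure lborel (D C) = ennreal \<theta>" "D C \<in> sets lborel" for C
    using \<open>\<theta> > 0\<close> by (simp_all add: D_def)
  ultimately have "measure lborel (\<Union>C\<in>components U. D C) = (\<Sum>C\<in>components U. measure lborel (D C))"
    using fin by (intro measure_finite_Union) (simp_all add: image_subset_iff)
  also have "\<dots> = real (card (components U)) * \<theta>" using \<open>\<theta> > 0\<close> by (simp add: D_def)
  finally have eq: "real (card (components U)) * \<theta> = measure lborel (\<Union>C\<in>components U. D C)" ..
  have J: "J \<in> sets borel" "J \<subseteq> {0..1}"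
    unfolding J_def using closed_Jset Jset_subset by auto
  have fJ: "J \<in> fmeasurable lborel"
    using J by (intro fmeasurableI2[OF fmeasurable_compact[OF compact_Icc]]) auto
  have sub: "{0..<\<theta> / 2} \<subseteq> J" using left \<open>\<theta> / 2 < 1\<close> by auto
  \<comment> \<open>By \<open>Sup_bounds\<close>, \<open>D C\<close> starts beyond \<theta>/2 and
    ends at or before 1 + \<theta>/2. The interval removed and the interval added both have length
    \<theta>/2, so they cancel in the final estimate.\<close>
  have "(\<Union>C\<in>components U. D C) \<subseteq> (J - {0..<\<theta> / 2}) \<union> {1<..<1 + \<theta> / 2}"
  proof
    fix x assume "x \<in> (\<Union>C\<in>components U. D C)"
    then obtain C where CC: "C \<in> components U" and x: "Sup C \<le> x" "x < Sup C + \<theta>" by (auto simp: D_def)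
    then show "x \<in> (J - {0..<\<theta> / 2}) \<union> {1<..<1 + \<theta> / 2}"
      using Sup_bounds[OF CC] after[OF CC x] by (cases "x \<le> 1") auto
  qed
  then have "measure lborel (\<Union>C\<in>components U. D C)
      \<le> measure lborel ((J - {0..<\<theta> / 2}) \<union> {1<..<1 + \<theta> / 2})"
    using fin fJ \<open>\<theta> > 0\<close> by (intro measure_mono_fmeasurable fmeasurable.Un fmeasurable.Diff)
      (auto simp: D_def fmeasurable_def)
  also have "\<dots> \<le> measure lborel (J - {0..<\<theta> / 2}) + measure lborel {1<..<1 + \<theta> / 2}"
    using J by (intro measure_Un_le) auto
  also have "measure lborel (J - {0..<\<theta> / 2}) = measure lborel J - measure lborel {0..<\<theta> / 2}"
    using J sub fJ by (intro measure_Diff) (auto simp: fmeasurable_def top_unique)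
  finally show ?thesis using eq \<open>\<theta> > 0\<close> by (simp add: U_def J_def)
qed

section \<open>The density measure, and the minimum and modulus of continuity of \<rho>\<close>

lemma measure_density_measure:
  assumes cont: "continuous_on {0..1} \<rho>" and pos: "\<And>x. x \<in> {0..1} \<Longrightarrow> \<rho> x > 0"
    and A: "A \<in> sets borel" "A \<subseteq> {0..1}"
  shows "measure (density_measure \<rho>) A = (LBINT x:A. \<rho> x)"
    and "set_integrable lborel A \<rho>"
proof -
  have int: "set_integrable lborel {0..1} \<rho>"
    unfolding set_integrable_def by (rule borel_integrable_compact) (use cont in auto)
  show intA: "set_integrable lborel A \<rho>"
    by (rule set_integrable_subset[OF int]) (use A in auto)
  \<comment> \<open>As \<rho> is arbitrary outside the unit interval, measurability is claimed only
    after cutting off.\<close>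
  have [measurable]: "(\<lambda>x. \<rho> x * indicator {0..1} x) \<in> borel_measurable borel"
    using borel_measurable_integrable[OF int[unfolded set_integrable_def]] by (simp add: mult.commute)
  have "emeasure (density_measure \<rho>) A
      = (\<integral>\<^sup>+x. ennreal (\<rho> x * indicator {0..1} x) * indicator A x \<partial>lborel)"
    unfolding density_measure_def using A by (subst emeasure_density) auto
  also have "\<dots> = (\<integral>\<^sup>+x. ennreal (indicator A x *\<^sub>R \<rho> x) \<partial>lborel)"
    using A by (intro nn_integral_cong) (auto simp: indicator_def)
  also have "\<dots> = ennreal (LBINT x:A. \<rho> x)"
    unfolding set_lebesgue_integral_def
  proof (rule nn_integral_eq_integral)
    show "integrable lborel (\<lambda>x. indicator A x *\<^sub>R \<rho> x)"
      using intA by (simp add: set_integrable_def)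
    show "AE x in lborel. 0 \<le> indicator A x *\<^sub>R \<rho> x"
      using A pos by (auto simp: indicator_def less_imp_le subset_iff)
  qed
  \<comment> \<open>\<open>ennreal\<close> sends negative numbers to 0, so the sign is needed to
    read the integral back off.\<close>
  moreover have "0 \<le> (LBINT x:A. \<rho> x)"
    unfolding set_lebesgue_integral_def
    using A pos by (intro integral_nonneg_AE AE_I2) (auto simp: indicator_def less_imp_le subset_iff)
  ultimately show "measure (density_measure \<rho>) A = (LBINT x:A. \<rho> x)"
    by (simp add: measure_def)
qed

lemma min_density_le:
  assumes "continuous_on {0..1} \<rho>" "x \<in> {0..1}"
  shows "min_density \<rho> \<le> \<rho> x"
  unfolding min_density_def
proof (rule cINF_lower)
  show "bdd_below (\<rho> ` {0..1})"
    using assms(1) by (intro bounded_imp_bdd_below compact_imp_bounded compact_continuous_image) auto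
qed fact

lemma min_density_pos:
  assumes "continuous_on {0..1} \<rho>" and pos: "\<And>x. x \<in> {0..1} \<Longrightarrow> \<rho> x > 0"
  shows "min_density \<rho> > 0"
proof -
  obtain x where "x \<in> {0..1}" and x: "\<And>y. y \<in> {0..1} \<Longrightarrow> \<rho> x \<le> \<rho> y"
    using continuous_attains_inf[of "{0..1}" \<rho>] assms(1) by auto
  then have "\<rho> x \<le> min_density \<rho>" unfolding min_density_def by (intro cINF_greatest) auto
  then show ?thesis using pos[OF \<open>x \<in> {0..1}\<close>] by simp
qed

lemma min_density_times_measure_le:
  assumes cont: "continuous_on {0..1} \<rho>" and pos: "\<And>x. x \<in> {0..1} \<Longrightarrow> \<rho> x > 0"
    and A: "A \<in> sets borel" "A \<subseteq> {0..1}"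
  shows "min_density \<rho> * measure lborel A \<le> (LBINT x:A. \<rho> x)"
proof -
  have "emeasure lborel A \<le> emeasure lborel {0..1::real}" using A by (intro emeasure_mono) auto
  then have fin: "emeasure lborel A < \<infinity>" by (auto intro: le_less_trans)
  then have "set_integrable lborel A (\<lambda>_. min_density \<rho>)"
    using A by (simp add: set_integrable_def)
  then have "(LBINT x:A. min_density \<rho>) \<le> (LBINT x:A. \<rho> x)"
    using measure_density_measure(2)[OF assms] min_density_le[OF cont] A
    by (intro set_integral_mono) auto
  then show ?thesis using A fin by (simp add: set_lebesgue_integral_def mult.commute)
qed

text \<open>Boundedness of \<open>\<rho>\<close> ensures that \<^const>\<open>eta\<close> is not the junk infimum of an empty set.\<close>
lemma eta_nonneg:
  assumes "continuous_on {0..1} \<rho>"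
  shows "eta \<rho> \<epsilon> \<ge> 0"
proof -
  have "bounded (\<rho> ` {0..1})"
    using assms by (intro compact_imp_bounded compact_continuous_image) auto
  then obtain B where B: "B > 0" "\<And>x. x \<in> {0..1} \<Longrightarrow> \<bar>\<rho> x\<bar> \<le> B"
    by (auto simp: bounded_pos)
  have "\<bar>\<rho> x - \<rho> y\<bar> \<le> 2 * B" if "x \<in> {0..1}" "y \<in> {0..1}" for x y
    using B(2)[OF that(1)] B(2)[OF that(2)] by linarith
  then show ?thesis
    unfolding eta_def using B(1) by (intro cInf_greatest) (auto intro!: exI[of _ "2 * B"])
qed

section \<open>The empirical measure and its discrepancy from the density measure\<close>

lemma prob_space_frac_measure:
  assumes "finite X" "X \<noteq> {}"
  shows "prob_space (frac_measure X)"
  unfolding frac_measure_def using assms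
  by (intro prob_space.prob_space_distr prob_space_uniform_count_measure)
     (auto simp: measurable_def space_uniform_count_measure sets_uniform_count_measure)

lemma measure_frac_measure_card:
  assumes "finite X" "X \<noteq> {}" "B \<in> sets borel"
  shows "measure (frac_measure X) B = real (card {\<alpha> \<in> X. frac \<alpha> \<in> B}) / real (card X)"
proof -
  have "measure (frac_measure X) B = measure (uniform_count_measure X) {\<alpha> \<in> X. frac \<alpha> \<in> B}"
    using assms unfolding frac_measure_def
    by (subst measure_distr) (auto simp: measurable_def space_uniform_count_measure
        sets_uniform_count_measure intro!: arg_cong2[where f = measure])
  then show ?thesis using assms by (simp add: measure_uniform_count_measure)
qed

lemma abs_measure_diff_le:
  assumes M: "prob_space M" "sets M = sets borel" and N: "prob_space N" "sets N = sets borel"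
    and F: "finite F" "disjoint F" "F \<subseteq> sets borel"
    and le: "\<And>I. I \<in> F \<Longrightarrow> \<bar>measure M I - measure N I\<bar> \<le> e"
  shows "\<bar>measure M (\<Union>F) - measure N (\<Union>F)\<bar> \<le> real (card F) * e"
proof -
  interpret M: prob_space M by fact
  interpret N: prob_space N by fact
  have dis: "disjoint_family_on (\<lambda>I. I) F"
    using F(2) by (auto simp: disjoint_family_on_def disjoint_def)
  have "measure M (\<Union>F) = (\<Sum>I\<in>F. measure M I)"
    using M.finite_measure_finite_Union[OF F(1) _ dis] F M by simp
  moreover have "measure N (\<Union>F) = (\<Sum>I\<in>F. measure N I)"
    using N.finite_measure_finite_Union[OF F(1) _ dis] F N by simp
  ultimately have "\<bar>measure M (\<Union>F) - measure N (\<Union>F)\<bar> = \<bar>\<Sum>I\<in>F. measure M I - measure N I\<bar>"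
    by (simp add: sum_subtractf)
  also have "\<dots> \<le> (\<Sum>I\<in>F. e)" by (rule order_trans[OF sum_abs sum_mono]) (rule le)
  finally show ?thesis by simp
qed

text \<open>A supremum of reals controls its family only if the family is bounded above. Here 1 is a
  bound, because both measures are probability measures.\<close>

lemma discrepancy_interval:
  assumes cont: "continuous_on {0..1} \<rho>" and pos: "\<And>x. x \<in> {0..1} \<Longrightarrow> \<rho> x > 0"
    and N: "prob_space (density_measure \<rho>)" and M: "prob_space M"
    and sup: "(SUP I\<in>{I. is_interval I \<and> I \<subseteq> {0..1}}. \<bar>measure M I - (LBINT x:I. \<rho> x)\<bar>) \<le> e"
    and I: "is_interval I" "I \<subseteq> {0..1}"
  shows "\<bar>measure M I - measure (density_measure \<rho>) I\<bar> \<le> e"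
proof -
  interpret M: prob_space M by fact
  interpret N: prob_space "density_measure \<rho>" by fact
  have eq: "measure (density_measure \<rho>) I = (LBINT x:I. \<rho> x)" if "is_interval I" "I \<subseteq> {0..1}" for I
    using that by (intro measure_density_measure real_interval_borel_measurable cont pos)
  have "bdd_above ((\<lambda>I. \<bar>measure M I - (LBINT x:I. \<rho> x)\<bar>) ` {I. is_interval I \<and> I \<subseteq> {0..1}})"
  proof (rule bdd_aboveI2)
    fix I :: "real set" assume "I \<in> {I. is_interval I \<and> I \<subseteq> {0..1}}"
    then have "(LBINT x:I. \<rho> x) = measure (density_measure \<rho>) I" using eq by simp
    moreover have "\<bar>measure M I - measure (density_measure \<rho>) I\<bar> \<le> 1"
      unfolding abs_le_iff using M.prob_le_1[of I] N.prob_le_1[of I]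
        measure_nonneg[of M I] measure_nonneg[of "density_measure \<rho>" I] by linarith
    ultimately show "\<bar>measure M I - (LBINT x:I. \<rho> x)\<bar> \<le> 1" by simp
  qed
  from cSUP_upper[OF _ this, of I] sup eq[OF I] I show ?thesis by auto
qed

text \<open>The density vanishes off the unit interval. This gives that interval full mass, so that
  complements can be taken inside it.\<close>

lemma measure_density_measure_unit_interval:
  assumes "continuous_on {0..1} \<rho>"
  shows "measure (density_measure \<rho>) {0..1} = measure (density_measure \<rho>) UNIV"
proof -
  have "integrable lborel (\<lambda>x. indicator {0..1} x *\<^sub>R \<rho> x)"
    by (rule borel_integrable_compact) (use assms in auto)
  from borel_measurable_integrable[OF this]
  have [measurable]: "(\<lambda>x. \<rho> x * indicator {0..1} x) \<in> borel_measurable borel"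
    by (simp add: mult.commute)
  have "emeasure (density_measure \<rho>) {0..1} = emeasure (density_measure \<rho>) UNIV"
    unfolding density_measure_def
    by (subst (1 2) emeasure_density) (auto intro!: nn_integral_cong split: split_indicator)
  then show ?thesis by (simp add: measure_def)
qed

section \<open>From counting intervals to the stated inequalities\<close>

text \<open>The arithmetic common to both bounds. Here \<open>b\<close> is the minimum of \<rho>,
  \<open>t\<close> is \<Theta> or \<open>l\<close>, \<open>e\<close> is \<open>E H\<close>,
  \<open>h\<close> is \<open>eta \<rho> t\<close>, \<open>k\<close> counts intervals, and
  \<open>m\<close>, \<open>L\<close> are the length and the \<rho>-integral of \<open>J\<close> or
  \<open>J'\<close>; \<open>m'\<close> is the length in the last term. The core is k e \<le> (m/t) e
  = e/(t b) * (b m), with b m \<le> L.\<close>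

lemma combine_bounds:
  fixes b t e h k m m' L x \<delta> :: real
  assumes "0 < b" "0 < t" "0 \<le> e" "0 \<le> h" "0 < \<delta>" "\<delta> < 1" "0 \<le> m" "0 \<le> m'"
    and k: "k * t \<le> m" and x: "x \<le> L + k * e" and L: "b * m \<le> L"
  shows "x \<le> 4 * L + (8 * \<delta> / (1 - \<delta>) + e / (t * b)) * (m * h + L) + 4 * m' * h"
proof -
  have "0 \<le> L" using L assms(1,7) by (meson mult_nonneg_nonneg less_imp_le order_trans)
  have mh: "0 \<le> m * h" "0 \<le> m' * h" using assms by simp_all
  have "k \<le> m / t" using k \<open>0 < t\<close> by (simp add: pos_le_divide_eq)
  then have "k * e \<le> m / t * e" using \<open>0 \<le> e\<close> by (rule mult_right_mono)
  also have "\<dots> = e / (t * b) * (b * m)" using \<open>0 < b\<close> \<open>0 < t\<close> by (simp add: field_simps)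
  also have "\<dots> \<le> e / (t * b) * (m * h + L)"
  proof (rule mult_left_mono)
    show "b * m \<le> m * h + L" using L mh by linarith
  qed (use assms in simp)
  finally have "x \<le> L + e / (t * b) * (m * h + L)" using x by linarith
  moreover have "0 \<le> 8 * \<delta> / (1 - \<delta>) * (m * h + L)" using assms mh \<open>0 \<le> L\<close> by simp
  ultimately show ?thesis using mh \<open>0 \<le> L\<close> by (simp add: distrib_right)
qed

theorem theorem3p1:
  fixes X :: "nat \<Rightarrow> real set" and \<rho> \<Psi> :: "real \<Rightarrow> real" and E :: "nat \<Rightarrow> real"
    and Q1 Q2 H :: nat
  assumes X: "\<And>h. h \<ge> 1 \<Longrightarrow> finite (X h) \<and> X h \<noteq> {}"
    and \<rho>_cont: "continuous_on {0..1} \<rho>"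
    and \<rho>_pos: "\<And>x. x \<in> {0..1} \<Longrightarrow> \<rho> x > 0"
    and \<rho>_prob: "prob_space (density_measure \<rho>)"
    and weak: "weak_conv_m (\<lambda>h. frac_measure (X h)) (density_measure \<rho>)"
    and E_nonneg: "\<And>h. h \<ge> 1 \<Longrightarrow> E h \<ge> 0"
    and E_bound: "\<And>h. h \<ge> 1 \<Longrightarrow>
      (SUP I\<in>{I. is_interval I \<and> I \<subseteq> {0..1}}.
         \<bar>measure (frac_measure (X h)) I - (LBINT x:I. \<rho> x)\<bar>) \<le> E h"
    and \<Psi>: "approximation_function \<Psi>"
    and Q: "1 \<le> Q1" "Q1 < Q2"
    and H: "1 \<le> H"
  shows
    "let J = Jset \<Psi> Q1 Q2;
         J' = Jtilde \<Psi> Q1 Q2;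
         P = real (card {\<alpha> \<in> X H. frac \<alpha> \<in> J}) / real (card (X H));
         \<Theta> = Min ((\<lambda>q. 2 * \<Psi> (real q) / real q) ` {Q1..<Q2});
         l = len_star J'
     in
       (\<forall>\<delta>. 0 < \<delta> \<and> \<delta> < 1 \<and> ereal \<Theta> < nu \<rho> \<delta> \<longrightarrow>
          P \<le> 4 * (LBINT x:J. \<rho> x)
             + (8 * \<delta> / (1 - \<delta>) + E H / (\<Theta> * min_density \<rho>))
               * (measure lborel J * eta \<rho> \<Theta> + (LBINT x:J. \<rho> x))
             + 4 * measure lborel J * eta \<rho> \<Theta>)
     \<and> (\<forall>\<delta>. 0 < \<delta> \<and> \<delta> < 1 \<and> 0 < l \<and> ereal l < nu \<rho> \<delta> \<longrightarrow>
          1 - P \<le> 4 * (LBINT x:J'. \<rho> x)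
             + (8 * \<delta> / (1 - \<delta>) + E H / (l * min_density \<rho>))
               * (measure lborel J' * eta \<rho> l + (LBINT x:J'. \<rho> x))
             + 4 * measure lborel (Jtilde (\<lambda>x. \<Psi> x / 2) Q1 Q2) * eta \<rho> l)
     \<and> (l = 0 \<longrightarrow> J = {0..1})"
proof -
  have \<Psi>_pos: "\<And>x. x > 0 \<Longrightarrow> \<Psi> x > 0"
    using \<Psi> unfolding approximation_function_def by blast
  define M where "M = frac_measure (X H)"
  define N where "N = density_measure \<rho>"
  define J where "J = Jset \<Psi> Q1 Q2"
  define J' where "J' = Jtilde \<Psi> Q1 Q2"
  define U where "U = {0..1} - J"
  define P where "P = real (card {\<alpha> \<in> X H. frac \<alpha> \<in> J}) / real (card (X H))"
  define \<Theta> where "\<Theta> = Min ((\<lambda>q. 2 * \<Psi> (real q) / real q) ` {Q1..<Q2})"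
  define l where "l = len_star J'"
  have XH: "finite (X H)" "X H \<noteq> {}" using X[OF H] by auto
  interpret M: prob_space M unfolding M_def by (rule prob_space_frac_measure[OF XH])
  interpret N: prob_space N unfolding N_def by (rule \<rho>_prob)
  have sets_M: "sets M = sets borel" by (simp add: M_def frac_measure_def)
  have sets_N: "sets N = sets borel" by (simp add: N_def density_measure_def)
  have M_eq: "measure M B = real (card {\<alpha> \<in> X H. frac \<alpha> \<in> B}) / real (card (X H))"
    if "B \<in> sets borel" for B
    unfolding M_def by (rule measure_frac_measure_card[OF XH that])
  have N_eq: "measure N A = (LBINT x:A. \<rho> x)" if "A \<in> sets borel" "A \<subseteq> {0..1}" for A
    unfolding N_def by (rule measure_density_measure(1)[OF \<rho>_cont \<rho>_pos that])
  have J: "J \<in> sets borel" "J \<subseteq> {0..1}"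
    unfolding J_def using closed_Jset Jset_subset by auto
  have P: "P = measure M J" using M_eq[OF J(1)] by (simp add: P_def)
  have "{\<alpha> \<in> X H. frac \<alpha> \<in> {0..1}} = X H" by (auto simp: frac_ge_0 frac_lt_1 less_imp_le)
  then have "measure M {0..1} = 1" using M_eq[of "{0..1}"] XH by simp
  then have MU: "measure M U = 1 - P"
    unfolding U_def P using J sets_M by (subst M.finite_measure_Diff) auto
  have "measure N {0..1} = 1"
    using measure_density_measure_unit_interval[OF \<rho>_cont] N.prob_space
    by (simp add: N_def density_measure_def)
  then have NU: "measure N U = 1 - measure N J"
    unfolding U_def using J sets_N by (subst N.finite_measure_Diff) auto
  have disc: "\<bar>measure M (\<Union>F) - measure N (\<Union>F)\<bar> \<le> real (card F) * E H"
    if F: "finite F" "disjoint F" "\<And>I. I \<in> F \<Longrightarrow> connected I \<and> I \<subseteq> {0..1}" for F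
  proof (rule abs_measure_diff_le[OF M.prob_space_axioms sets_M N.prob_space_axioms sets_N F(1,2)])
    have F': "is_interval I" "I \<subseteq> {0..1}" if "I \<in> F" for I
      using F(3)[OF that] by (simp_all add: is_interval_connected_1)
    then show "F \<subseteq> sets borel" using real_interval_borel_measurable by blast
    show "\<bar>measure M I - measure N I\<bar> \<le> E H" if "I \<in> F" for I
      unfolding M_def N_def
      using discrepancy_interval[OF \<rho>_cont \<rho>_pos \<rho>_prob _ E_bound[OF H] F'[OF that]]
        prob_space_frac_measure[OF XH] by simp
  qed
  note combine = combine_bounds[OF min_density_pos[OF \<rho>_cont \<rho>_pos] _ E_nonneg[OF H]
      eta_nonneg[OF \<rho>_cont] _ _ measure_nonneg measure_nonneg]
  have "\<exists>F. finite F \<and> (\<forall>I\<in>F. open I \<and> is_interval I) \<and> \<Union>F = U"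
    unfolding U_def J_def by (rule Compl_Jset_decompose[OF \<Psi>_pos Q])
  then obtain F where "finite F \<and> (\<forall>I\<in>F. open I \<and> is_interval I) \<and> \<Union>F = U" ..
  then have F: "finite F" "\<And>I. I \<in> F \<Longrightarrow> open I \<and> connected I" and UF: "\<Union>F = U"
    by (simp_all add: is_interval_connected)
  have bdd_U: "bounded U" by (rule bounded_subset[of "{0..1}"]) (auto simp: U_def)

  have upper: "P \<le> 4 * (LBINT x:J. \<rho> x)
             + (8 * \<delta> / (1 - \<delta>) + E H / (\<Theta> * min_density \<rho>))
               * (measure lborel J * eta \<rho> \<Theta> + (LBINT x:J. \<rho> x))
             + 4 * measure lborel J * eta \<rho> \<Theta>" if "0 < \<delta>" "\<delta> < 1" for \<delta>
  proof (rule combine)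
    have \<Theta>_le: "\<Theta> \<le> 2 * \<Psi> (real q) / real q" if "q \<in> {Q1..<Q2}" for q
      unfolding \<Theta>_def using that by (intro Min_le) auto
    show "\<Theta> > 0" unfolding \<Theta>_def using Q \<Psi>_pos by (subst Min_gr_iff) auto
    then show "real (card (components U)) * \<Theta> \<le> measure lborel J"
      unfolding U_def J_def using card_gaps_le[OF \<Psi>_pos Q _ \<Theta>_le] by blast
    have fin: "finite (components U)"
      unfolding UF[symmetric] using F by (intro finite_components_Union) auto
    have "\<bar>measure M (\<Union>(components U)) - measure N (\<Union>(components U))\<bar>
        \<le> real (card (components U)) * E H"
    proof (rule disc[OF fin disjoint_components])
      fix I assume I: "I \<in> components U"
      show "connected I \<and> I \<subseteq> {0..1}"
        using in_components_connected[OF I] in_components_subset[OF I] by (auto simp: U_def)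
    qed
    \<comment> \<open>Both measures give the unit interval mass 1, so their difference on the union
      \<open>U\<close> of the gaps is, up to sign, their difference on \<open>J\<close>.\<close>
    then show "P \<le> (LBINT x:J. \<rho> x) + real (card (components U)) * E H"
      using MU NU N_eq[OF J] by (simp add: abs_le_iff)
    show "min_density \<rho> * measure lborel J \<le> (LBINT x:J. \<rho> x)" 
      by (rule min_density_times_measure_le[OF \<rho>_cont \<rho>_pos J])
  qed (use that in auto)

  have J'_eq: "J' = closure U" by (simp add: J'_def Jtilde_def U_def J_def)
  have J': "J' \<in> sets borel" "J' \<subseteq> {0..1}"
    unfolding J'_eq using closure_minimal[of U "{0..1}"] by (auto simp: U_def)
  have fin': "finite (components J')" and pos': "\<And>C. C \<in> components J' \<Longrightarrow> measure lborel C > 0"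
    using components_closure_Union[OF F] bdd_U unfolding UF J'_eq by blast+
  have l_eq: "l = Min (measure lborel ` components J')" if "J' \<noteq> {}"
    using that by (simp add: l_def len_star_def)
  have comp': "C \<in> sets borel" "C \<subseteq> {0..1}" "connected C" if "C \<in> components J'" for C
    using closed_components[OF _ that] in_components_subset[OF that] J'(2)
      in_components_connected[OF that] by (auto simp: J'_eq)

  have lower: "1 - P \<le> 4 * (LBINT x:J'. \<rho> x)
             + (8 * \<delta> / (1 - \<delta>) + E H / (l * min_density \<rho>))
               * (measure lborel J' * eta \<rho> l + (LBINT x:J'. \<rho> x))
             + 4 * measure lborel (Jtilde (\<lambda>x. \<Psi> x / 2) Q1 Q2) * eta \<rho> l"
    if "0 < \<delta>" "\<delta> < 1" "0 < l" for \<delta>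
  proof (rule combine)
    show "l > 0" by fact
    \<comment> \<open>The value of \<open>len_star\<close> at the empty set is 0, so a positive
      \<open>l\<close> is a genuine minimum over components.\<close>
    then have "J' \<noteq> {}" by (auto simp: l_def len_star_def)
    have fm: "emeasure lborel C \<noteq> \<infinity>" if "C \<subseteq> {0..1::real}" for C
      using emeasure_mono[OF that, of lborel] by (auto simp: top_unique)
    have "real (card (components J')) * l = (\<Sum>C\<in>components J'. l)" by simp
    also have "\<dots> \<le> (\<Sum>C\<in>components J'. measure lborel C)"
      unfolding l_eq[OF \<open>J' \<noteq> {}\<close>] using fin' by (intro sum_mono Min_le) auto
    also have "\<dots> = measure lborel (\<Union>C\<in>components J'. C)"
      using fin' disjoint_components[of J'] comp'(1) fm[OF comp'(2)]
      by (intro measure_finite_Union[symmetric]) (auto simp: disjoint_family_on_def disjoint_def)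
    finally show "real (card (components J')) * l \<le> measure lborel J'" by simp
    have "\<bar>measure M (\<Union>(components J')) - measure N (\<Union>(components J'))\<bar>
        \<le> real (card (components J')) * E H"
      using comp' by (intro disc[OF fin' disjoint_components]) blast
    \<comment> \<open>The empirical measure has atoms and may charge the boundary points added by
      the closure; only this inequality is needed.\<close>
    moreover have "measure M U \<le> measure M J'"
      using J' sets_M closure_subset[of U] by (intro M.finite_measure_mono) (auto simp: J'_eq)
    ultimately show "1 - P \<le> (LBINT x:J'. \<rho> x) + real (card (components J')) * E H"
      using MU N_eq[OF J'] by (simp add: abs_le_iff)
    show "min_density \<rho> * measure lborel J' \<le> (LBINT x:J'. \<rho> x)" 
      by (rule min_density_times_measure_le[OF \<rho>_cont \<rho>_pos J'])
  qed (use that in auto)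

  have full: "J = {0..1}" if "l = 0"
  proof -
    \<comment> \<open>A nonempty \<open>J'\<close> has finitely many components, all of positive
      length, so \<open>l = 0\<close> can only be the value at the empty set.\<close>
    have "J' = {}"
    proof (rule ccontr)
      assume "J' \<noteq> {}"
      then have "l > 0"
        unfolding l_eq[OF \<open>J' \<noteq> {}\<close>] using fin' pos' by (subst Min_gr_iff) auto
      then show False using that by simp
    qed
    then have "U = {}" by (simp add: J'_eq)
    then show ?thesis using J(2) by (auto simp: U_def)
  qed
  show ?thesis
    unfolding Let_def J_def[symmetric] J'_def[symmetric] P_def[symmetric] \<Theta>_def[symmetric]
      l_def[symmetric]
    using upper lower full by blast
qed

end
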